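(* Let $\mathfrak{h}$ be any $4$-dimensional real Lie algebra. Then there is a $3$-dimensional unimodular real Lie algebra $\mathfrak{g}$ such that $\mathfrak{h}$ is isomorphic to a central extension $\mathfrak{g}_\omega$ of $\mathfrak{g}$ by $\mathbb{R}$ (for some $2$-cocycle $\omega$ of $\mathfrak{g}$) or to a D-extension $\mathfrak{g}_D$ of $\mathfrak{g}$ (for some derivation $D$ of $\mathfrak{g}$).
   Context: All Lie algebras are over $\mathbb{R}$. A Lie algebra $\mathfrak{g}$ is unimodular if $\operatorname{tr}(\operatorname{ad}\xi)=0$ for all $\xi\in\mathfrak{g}$. Central extension: for a Chevalley–Eilenberg $2$-cocycle $\omega\in\wedge^2\mathfrak{g}^*$ (coefficients in the trivial representation $\mathbb{R}$), $\mathfrak{g}_\omega=\mathfrak{g}\oplus\mathbb{R}$ as a vector space, with bracket $[\xi\oplus t,\eta\oplus s]=[\xi,\eta]\oplus\omega(\xi,\eta)$. D-extension: for a derivation $D$ of $\mathfrak{g}$, $\mathfrak{g}_D=\mathfrak{g}\oplus\mathbb{R}e$ as a vector space, where $\mathfrak{g}$ is a subalgebra with its given bracket and $[\xi,e]=D(\xi)$ for $\xi\in\mathfrak{g}$. *)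

theory Defs
  imports "HOL-Analysis.Analysis"
begin

text \<open>A Lie algebra structure over the reals on the underlying vector space of a type.\<close>

definition lie_algebra :: "('a::real_vector \<Rightarrow> 'a \<Rightarrow> 'a) \<Rightarrow> bool" where
  "lie_algebra br \<longleftrightarrow>
     bilinear br \<and>
     (\<forall>x. br x x = 0) \<and>
     (\<forall>x y z. br x (br y z) + br y (br z x) + br z (br x y) = 0)"

definition lie_isomorphic ::
  "('a::real_vector \<Rightarrow> 'a \<Rightarrow> 'a) \<Rightarrow> ('b::real_vector \<Rightarrow> 'b \<Rightarrow> 'b) \<Rightarrow> bool" where
  "lie_isomorphic br br' \<longleftrightarrow>
     (\<exists>f. linear f \<and> bij f \<and> (\<forall>x y. f (br x y) = br' (f x) (f y)))"

text \<open>Here \<open>br x\<close> is the adjoint map of \<open>x\<close>, and its trace is computed from its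
  matrix in the standard basis.\<close>

definition unimodular :: "(real^'n \<Rightarrow> real^'n \<Rightarrow> real^'n) \<Rightarrow> bool" where
  "unimodular br \<longleftrightarrow> (\<forall>x. trace (matrix (br x)) = 0)"

text \<open>Chevalley--Eilenberg 2-cocycles with trivial real coefficients: alternating
  bilinear forms with vanishing differential (the sum below is the differential up to sign).\<close>

definition two_cocycle ::
  "('a::real_vector \<Rightarrow> 'a \<Rightarrow> 'a) \<Rightarrow> ('a \<Rightarrow> 'a \<Rightarrow> real) \<Rightarrow> bool" where
  "two_cocycle br \<omega> \<longleftrightarrow>
     bilinear \<omega> \<and>
     (\<forall>x. \<omega> x x = 0) \<and>
     (\<forall>x y z. \<omega> (br x y) z + \<omega> (br y z) x + \<omega> (br z x) y = 0)"

definition derivation :: "('a::real_vector \<Rightarrow> 'a \<Rightarrow> 'a) \<Rightarrow> ('a \<Rightarrow> 'a) \<Rightarrow> bool" where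
  "derivation br D \<longleftrightarrow> linear D \<and> (\<forall>x y. D (br x y) = br (D x) y + br x (D y))"

definition central_extension ::
  "('a::real_vector \<Rightarrow> 'a \<Rightarrow> 'a) \<Rightarrow> ('a \<Rightarrow> 'a \<Rightarrow> real) \<Rightarrow> 'a \<times> real \<Rightarrow> 'a \<times> real \<Rightarrow> 'a \<times> real" where
  "central_extension br \<omega> u v = (br (fst u) (fst v), \<omega> (fst u) (fst v))"

text \<open>The pair \<open>(x, t)\<close> stands for \<open>x + t e\<close>; the formula is the bilinear alternating
  extension of the bracket of the subalgebra and \<open>[x, e] = D x\<close>.\<close>

definition D_extension ::
  "('a::real_vector \<Rightarrow> 'a \<Rightarrow> 'a) \<Rightarrow> ('a \<Rightarrow> 'a) \<Rightarrow> 'a \<times> real \<Rightarrow> 'a \<times> real \<Rightarrow> 'a \<times> real" where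
  "D_extension br D u v =
     (br (fst u) (fst v) + snd v *\<^sub>R D (fst u) - snd u *\<^sub>R D (fst v), 0)"

lemma D_extension_subalgebra:
  assumes "derivation br D"
  shows "D_extension br D (x, 0) (y, 0) = (br x y, 0)"
  by (simp add: D_extension_def)

lemma D_extension_e:
  assumes "lie_algebra br" "derivation br D"
  shows "D_extension br D (x, 0) (0, 1) = (D x, 0)"
  using assms by (simp add: D_extension_def lie_algebra_def derivation_def bilinear_rzero linear_0)

lemma lie_algebra_anticomm:
  assumes "lie_algebra br"
  shows "br x y = - br y x"
proof -
  have "br (x + y) (x + y) = 0" "br x x = 0" "br y y = 0" "bilinear br"
    using assms by (auto simp: lie_algebra_def)
  then show ?thesis
    by (simp add: bilinear_ladd bilinear_radd add_eq_0_iff)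
qed

lemma lie_algebra_central_extension:
  assumes L: "lie_algebra br" and C: "two_cocycle br \<omega>"
  shows "lie_algebra (central_extension br \<omega>)"
proof -
  have bl: "bilinear br" "bilinear \<omega>"
    using L C by (auto simp: lie_algebra_def two_cocycle_def)
  have "bilinear (central_extension br \<omega>)"
    unfolding bilinear_def
    by (intro conjI allI linearI)
      (simp_all add: central_extension_def bilinear_ladd[OF bl(1)] bilinear_radd[OF bl(1)]
        bilinear_lmul[OF bl(1)] bilinear_rmul[OF bl(1)] bilinear_ladd[OF bl(2)]
        bilinear_radd[OF bl(2)] bilinear_lmul[OF bl(2)] bilinear_rmul[OF bl(2)])
  moreover have "\<omega> x y = - \<omega> y x" for x y
  proof -
    have "\<omega> (x + y) (x + y) = 0" "\<omega> x x = 0" "\<omega> y y = 0"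
      using C by (auto simp: two_cocycle_def)
    then show ?thesis
      using bl(2) by (simp add: bilinear_ladd bilinear_radd)
  qed
  then have "\<omega> x (br y z) + \<omega> y (br z x) + \<omega> z (br x y) = 0" for x y z
    using C unfolding two_cocycle_def by (smt (verit))
  ultimately show ?thesis
    using L C by (auto simp: lie_algebra_def two_cocycle_def central_extension_def zero_prod_def)
qed

lemma lie_algebra_D_extension:
  assumes L: "lie_algebra br" and D: "derivation br D"
  shows "lie_algebra (D_extension br D)"
proof -
  have bl: "bilinear br" and lin: "linear D"
    using L D by (auto simp: lie_algebra_def derivation_def)
  note bs = bilinear_ladd[OF bl] bilinear_radd[OF bl] bilinear_lmul[OF bl] bilinear_rmul[OF bl]
    bilinear_lsub[OF bl] bilinear_rsub[OF bl]
    linear_add[OF lin] linear_diff[OF lin] linear_cmul[OF lin]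
  have bil: "bilinear (D_extension br D)"
    unfolding bilinear_def
    by (intro conjI allI linearI) (simp_all add: D_extension_def bs algebra_simps)
  have alt: "D_extension br D u u = 0" for u
    using L by (simp add: D_extension_def lie_algebra_def zero_prod_def)
  have jac: "D_extension br D u (D_extension br D v w) + D_extension br D v (D_extension br D w u)
        + D_extension br D w (D_extension br D u v) = 0" for u v w
  proof -
    obtain x a y b z c where uvw: "u = (x, a)" "v = (y, b)" "w = (z, c)"
      by (metis surj_pair)
    have der: "D (br p q) = br (D p) q + br p (D q)" for p q
      using D by (simp add: derivation_def)
    have "br x (br y z) + br y (br z x) + br z (br x y) = 0"
      using L by (simp add: lie_algebra_def)
    then have J: "br x (br y z) = - br y (br z x) - br z (br x y)"
      by (simp only: eq_diff_eq eq_neg_iff_add_eq_0 ac_simps)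
    have A: "br (D x) y = - br y (D x)" "br (D y) z = - br z (D y)" "br (D z) x = - br x (D z)"
      by (rule lie_algebra_anticomm[OF L])+
    show ?thesis
      by (simp add: uvw D_extension_def bs der J A zero_prod_def algebra_simps)
  qed
  show ?thesis
    using bil alt jac by (simp add: lie_algebra_def)
qed

end

theory Submission
  imports Defs
begin

text \<open>Every 4-dimensional Lie algebra \<open>h\<close> is a D-extension. It suffices to find a nonzero functional
  \<open>a\<close> that vanishes on \<open>[h, h]\<close> and whose kernel consists of elements with traceless adjoint map:
  the kernel is then an ideal, and it is unimodular because \<open>ad x\<close> maps \<open>h\<close> into it.
  If \<open>h\<close> is not unimodular, \<open>a = tr \<circ> ad\<close> works. If \<open>h\<close> is unimodular, all 3-forms are closed, so
  \<open>da \<and> da = d (a \<and> da) = 0\<close> for every functional \<open>a\<close>. Self-duality of \<open>da\<close> amounts to three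
  linear equations on the 4-dimensional dual space, so some \<open>a \<noteq> 0\<close> satisfies it, and then
  \<open>da \<and> da\<close> is a positive multiple of \<open>|da|\<^sup>2\<close>, whence \<open>da = 0\<close>.\<close>

section \<open>Coordinates and transport of structure\<close>

text \<open>The abstract carrier is traded for \<open>real^'n\<close>, where matrices, traces and
  the inner product can be used.\<close>

lemma obtain_coordinates:
  assumes "dim (UNIV :: 'h::real_vector set) = CARD('n::finite)"
  obtains F :: "'h::real_vector \<Rightarrow> real^'n::finite" and G :: "real^'n::finite \<Rightarrow> 'h::real_vector"
  where "linear F" "linear G" "\<And>x. G (F x) = x" "\<And>y. F (G y) = y"
proof -
  obtain B :: "'h set" where B: "independent B" "UNIV \<subseteq> span B" "card B = CARD('n)"
    using basis_exists[of "UNIV :: 'h set"] assms by metis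
  \<comment> \<open>An infinite set has \<open>card\<close> equal to 0, while
    \<open>CARD('n)\<close> is positive, so the dimension hypothesis forces a finite basis.\<close>
  have fin: "finite B"
    using B(3) by (metis card.infinite zero_less_card_finite less_irrefl)
  obtain e :: "'n \<Rightarrow> 'h" where e: "bij_betw e UNIV B"
    using bij_betw_iff_card[of "UNIV :: 'n set" B] fin B(3) by auto
  define G where "G y = (\<Sum>i\<in>UNIV. (y $ i) *\<^sub>R e i)" for y :: "real^'n"
  have linG: "linear G"
    by (rule linearI) (simp_all add: G_def scaleR_add_left sum.distrib scaleR_sum_right)
  have reindex: "(\<Sum>i\<in>UNIV. u (e i) *\<^sub>R e i) = (\<Sum>v\<in>B. u v *\<^sub>R v)" for u
    using sum.reindex_bij_betw[OF e, of "\<lambda>v. u v *\<^sub>R v"] by simp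
  have "inj G"
    unfolding linear_injective_0[OF linG]
  proof (intro allI impI)
    fix y assume "G y = 0"
    define u where "u v = y $ inv_into UNIV e v" for v
    have u: "u (e i) = y $ i" for i
      using e by (simp add: u_def bij_betw_def)
    then have "(\<Sum>v\<in>B. u v *\<^sub>R v) = 0"
      using reindex[of u] \<open>G y = 0\<close> by (simp add: G_def)
    then have "u v = 0" if "v \<in> B" for v
      using that by (intro independentD[OF B(1) fin order_refl])
    then have "y $ i = 0" for i
      using u[of i] bij_betwE[OF e] by simp
    then show "y = 0"
      by (simp add: vec_eq_iff)
  qed
  have "surj G"
  proof (rule surjI)
    fix x :: 'h
    have "x \<in> range (\<lambda>u. \<Sum>v\<in>B. u v *\<^sub>R v)"
      using B(2) span_finite[OF fin] by blast
    then obtain u where "x = (\<Sum>v\<in>B. u v *\<^sub>R v)"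
      by blast
    then have "x = G (\<chi> i. u (e i))"
      using reindex[of u] by (simp add: G_def)
    then show "G (SOME y. G y = x) = x"
      by (metis (mono_tags, lifting) someI)
  qed
  have inv: "inv G (G y) = y" "G (inv G x) = x" for x y
    using \<open>inj G\<close> \<open>surj G\<close> by (auto simp: surj_f_inv_f)
  have "linear (inv G)"
    by (rule linearI; rule injD[OF \<open>inj G\<close>])
      (simp_all add: inv linear_add[OF linG] linear_cmul[OF linG])
  then show thesis
    using that linG inv by blast
qed

lemma lie_algebra_transport:
  fixes b :: "'a::real_vector \<Rightarrow> 'a \<Rightarrow> 'a" and F :: "'a \<Rightarrow> 'b::real_vector"
  assumes L: "lie_algebra b" and F: "linear F" and G: "linear G" and GF: "\<And>x. G (F x) = x"
  shows "lie_algebra (\<lambda>x y. F (b (G x) (G y)))"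
proof -
  have bl: "bilinear b"
    using L by (simp add: lie_algebra_def)
  have "bilinear (\<lambda>x y. F (b (G x) (G y)))"
    unfolding bilinear_def
    by (intro conjI allI linearI)
      (simp_all add: linear_add[OF F] linear_add[OF G] linear_cmul[OF F] linear_cmul[OF G]
        bilinear_ladd[OF bl] bilinear_radd[OF bl] bilinear_lmul[OF bl] bilinear_rmul[OF bl])
  moreover have "F (b (G x) (b (G y) (G z))) + F (b (G y) (b (G z) (G x)))
      + F (b (G z) (b (G x) (G y))) = 0" for x y z
    using L by (simp add: lie_algebra_def linear_0[OF F] flip: linear_add[OF F])
  ultimately show ?thesis
    using L by (simp add: lie_algebra_def GF linear_0[OF F])
qed

text \<open>Cyclicity of the trace brings \<open>matrix G\<close> and \<open>matrix F\<close>
  together in the order in which their product is the identity.\<close>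

lemma trace_conjugate:
  fixes F G :: "real^'n \<Rightarrow> real^'n"
  assumes "linear F" "linear G" "linear L" "\<And>x. G (F x) = x"
  shows "trace (matrix (\<lambda>x. F (L (G x)))) = trace (matrix L)"
proof -
  have "G \<circ> F = id"
    using assms(4) by auto
  then have GF: "matrix G ** matrix F = mat 1"
    using matrix_compose[OF assms(1,2)] by (simp add: matrix_id_mat_1)
  have "(\<lambda>x. F (L (G x))) = F \<circ> (L \<circ> G)"
    by auto
  then have "matrix (\<lambda>x. F (L (G x))) = matrix F ** (matrix L ** matrix G)"
    using assms by (simp add: matrix_compose linear_compose)
  then show ?thesis
    by (metis GF matrix_mul_assoc matrix_mul_rid trace_mul_sym)
qed

section \<open>Functionals that vanish on brackets and have a traceless kernel\<close>

text \<open>In terms of the structure constants \<open>c\<close> and the functional \<open>p\<close>, the conclusion says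
  \<open>dp \<and> dp = 0\<close>. The identity in the proof is \<open>dp \<and> dp = d (p \<and> dp) + p \<and> ddp\<close> evaluated on
  the standard basis: \<open>th\<close> is \<open>p \<and> dp\<close>, and \<open>J\<close> is \<open>ddp\<close>.\<close>

lemma unimodular_Pfaffian_eq_0:
  fixes c :: "4 \<Rightarrow> 4 \<Rightarrow> 4 \<Rightarrow> real" and p :: "4 \<Rightarrow> real"
  assumes alt: "\<And>i k. c i i k = 0" and anti: "\<And>i j k. c i j k = - c j i k"
    and jac: "\<And>i j k l. (\<Sum>m\<in>UNIV. c j k m * c i m l + c k i m * c j m l + c i j m * c k m l) = 0"
    and tr: "\<And>i. (\<Sum>j\<in>UNIV. c i j j) = 0"
  defines "A \<equiv> \<lambda>i j. \<Sum>k\<in>UNIV. c i j k * p k"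
  shows "A 1 2 * A 3 4 - A 1 3 * A 2 4 + A 1 4 * A 2 3 = 0"
proof -
  define T where "T i = (\<Sum>j\<in>UNIV. c i j j)" for i
  define J where "J i j k =
    (\<Sum>l\<in>UNIV. (\<Sum>m\<in>UNIV. c j k m * c i m l + c k i m * c j m l + c i j m * c k m l) * p l)"
    for i j k
  define th where "th i j k = p i * A j k - p j * A i k + p k * A i j" for i j k
  note anti' = anti[of 2 1] anti[of 3 1] anti[of 4 1] anti[of 3 2] anti[of 4 2] anti[of 4 3]
  \<comment> \<open>The left side is the value of \<open>dp \<and> dp\<close> on the basis, whence
    the factor 2. In dimension 4 the differential of a 3-form is, up to sign, its wedge product with
    the trace form \<open>T\<close>; this gives the bracketed sum. The \<open>J\<close> terms are
    \<open>p \<and> J\<close> up to sign.\<close>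
  have "2 * (A 1 2 * A 3 4 - A 1 3 * A 2 4 + A 1 4 * A 2 3) =
     p 4 * J 1 2 3 - p 3 * J 1 2 4 + p 2 * J 1 3 4 - p 1 * J 2 3 4
     + (T 1 * th 2 3 4 - T 2 * th 1 3 4 + T 3 * th 1 2 4 - T 4 * th 1 2 3)"
    unfolding th_def J_def T_def A_def sum_4 alt anti' by algebra
  moreover have "J i j k = 0" "T i = 0" for i j k
    unfolding J_def T_def jac tr by auto
  ultimately show ?thesis
    by simp
qed

text \<open>By the Jacobi identity the adjoint map of a bracket is a commutator of adjoint maps, and
  commutators have trace zero.\<close>

lemma trace_ad_bracket:
  fixes b :: "real^'n \<Rightarrow> real^'n \<Rightarrow> real^'n"
  assumes L: "lie_algebra b"
  shows "trace (matrix (b (b x y))) = 0"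
proof -
  have bl: "bilinear b"
    using L by (simp add: lie_algebra_def)
  have lin: "linear (b x)" for x
    using bl by (simp add: bilinear_def)
  have "b (b x y) z = b x (b y z) - b y (b x z)" for z
  proof -
    have "b x (b y z) + b y (b z x) + b z (b x y) = 0"
      using L by (simp add: lie_algebra_def)
    moreover have "b z (b x y) = - b (b x y) z"
      by (rule lie_algebra_anticomm[OF L])
    moreover have "b y (b z x) = - b y (b x z)"
      by (subst lie_algebra_anticomm[OF L, of z x]) (simp add: bilinear_rneg[OF bl])
    ultimately show ?thesis
      by (simp add: algebra_simps)
  qed
  then have "matrix (b (b x y)) = matrix (b x \<circ> b y) - matrix (b y \<circ> b x)"
    by (simp add: matrix_def vec_eq_iff)
  then show ?thesis
    by (simp add: matrix_compose lin trace_sub trace_mul_sym[of "matrix (b y)"])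
qed

lemma ex_traceless_functional:
  fixes b :: "real^4 \<Rightarrow> real^4 \<Rightarrow> real^4"
  assumes L: "lie_algebra b"
  obtains a where "a \<noteq> 0" "\<And>x y. a \<bullet> b x y = 0"
    "\<And>x. a \<bullet> x = 0 \<Longrightarrow> trace (matrix (b x)) = 0"
proof (cases "unimodular b")
  case False
  have bl: "bilinear b"
    using L by (simp add: lie_algebra_def)
  define \<tau> where "\<tau> x = trace (matrix (b x))" for x
  have lin: "linear \<tau>"
    by (rule linearI)
      (simp_all add: \<tau>_def trace_def matrix_def bilinear_ladd[OF bl] bilinear_lmul[OF bl]
        sum.distrib sum_distrib_left)
  \<comment> \<open>The vector \<open>adjoint \<tau> 1\<close> represents the functional
    \<open>\<tau>\<close> with respect to the inner product.\<close>
  have \<tau>: "\<tau> x = adjoint \<tau> 1 \<bullet> x" for x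
    using adjoint_works[OF lin, of x 1] by (simp add: inner_commute)
  show thesis
  proof (rule that[of "adjoint \<tau> 1"])
    show "adjoint \<tau> 1 \<noteq> 0"
    proof
      assume "adjoint \<tau> 1 = 0"
      then have "\<tau> x = 0" for x
        by (simp add: \<tau>)
      with False show False
        by (simp add: unimodular_def \<tau>_def)
    qed
    show "adjoint \<tau> 1 \<bullet> b x y = 0" for x y
      using trace_ad_bracket[OF L] by (simp add: \<tau>_def flip: \<tau>)
    show "trace (matrix (b x)) = 0" if "adjoint \<tau> 1 \<bullet> x = 0" for x
      using that by (simp add: \<tau>_def flip: \<tau>)
  qed
next
  case True
  have bl: "bilinear b"
    using L by (simp add: lie_algebra_def)
  define B where "B i j = b (axis i 1) (axis j 1)" for i j
  \<comment> \<open>Up to sign these are the anti-self-dual components of \<open>dp\<close>, so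
    \<open>S p = 0\<close> says that \<open>dp\<close> is self-dual. As \<open>S\<close> maps
    dimension 4 to dimension 3, its kernel is nonzero.\<close>
  define S where "S p = (vector [p \<bullet> B 1 2 - p \<bullet> B 3 4, p \<bullet> B 1 3 + p \<bullet> B 2 4,
    p \<bullet> B 1 4 - p \<bullet> B 2 3] :: real^3)" for p
  have linS: "linear S"
    by (rule linearI)
      (simp_all add: S_def vec_eq_iff forall_3 inner_add_left algebra_simps)
  have "\<not> inj S"
  proof
    assume "inj S"
    then have "dim (range S) = CARD(4)"
      using dim_image_eq[OF linS, of UNIV] by simp
    then show False
      using dim_subset_UNIV[of "range S"] by simp
  qed
  then obtain a where a: "a \<noteq> 0" "S a = 0"
    using linear_injective_0[OF linS] by blast
  define c where "c i j k = B i j $ k" for i j k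
  define A where "A i j = (\<Sum>k\<in>UNIV. c i j k * a $ k)" for i j
  have A: "a \<bullet> B i j = A i j" for i j
    by (simp add: A_def c_def inner_vec_def mult.commute)
  have expand: "b (axis i 1) y $ l = (\<Sum>m\<in>UNIV. y $ m * c i m l)" for i y l
  proof -
    have "linear (b (axis i 1))"
      using bl by (simp add: bilinear_def)
    then have "b (axis i 1) y $ l = (matrix (b (axis i 1)) *v y) $ l"
      by simp
    then show ?thesis
      by (simp add: matrix_vector_mult_def matrix_def c_def B_def mult.commute)
  qed
  have alt: "c i i k = 0" for i k
    using L by (simp add: c_def B_def lie_algebra_def)
  have anti: "c i j k = - c j i k" for i j k
    unfolding c_def B_def by (subst lie_algebra_anticomm[OF L]) simp
  have jac: "(\<Sum>m\<in>UNIV. c j k m * c i m l + c k i m * c j m l + c i j m * c k m l) = 0" for i j k l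
  proof -
    have "(b (axis i 1) (B j k) + b (axis j 1) (B k i) + b (axis k 1) (B i j)) $ l = 0"
      using L by (simp add: B_def lie_algebra_def)
    then show ?thesis
      by (simp add: expand sum.distrib flip: c_def)
  qed
  have tr: "(\<Sum>j\<in>UNIV. c i j j) = 0" for i
    using True by (simp add: unimodular_def trace_def matrix_def c_def B_def)
  have sd: "A 1 2 = A 3 4" "A 1 3 = - A 2 4" "A 1 4 = A 2 3"
    using a(2) by (simp_all add: S_def A vec_eq_iff forall_3)
  have "A 1 2 * A 3 4 - A 1 3 * A 2 4 + A 1 4 * A 2 3 = 0"
    unfolding A_def by (rule unimodular_Pfaffian_eq_0[OF alt anti jac tr])
  \<comment> \<open>Substituting the self-duality relations turns each product in the Pfaffian into
    a square with positive sign.\<close>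
  then have "(A 3 4)\<^sup>2 + (A 2 4)\<^sup>2 + (A 2 3)\<^sup>2 = 0"
    by (simp add: sd power2_eq_square)
  then have "A 3 4 = 0" "A 2 4 = 0" "A 2 3 = 0"
    by (smt (verit) zero_le_power2 zero_eq_power2)+
  then have "A i j = 0" if "i = 1 \<and> j \<in> {2,3,4} \<or> i = 2 \<and> j \<in> {3,4} \<or> i = 3 \<and> j = 4" for i j
    using that sd by auto
  moreover have "A i i = 0" "A i j = - A j i" for i j
    by (simp_all add: A_def alt anti[of i j] sum_negf)
  ultimately have A0: "A i j = 0" for i j
    using exhaust_4[of i] exhaust_4[of j] by (smt (verit) insertCI)
  have "bilinear (\<lambda>x y. a \<bullet> b x y)"
    unfolding bilinear_def
    by (intro conjI allI linearI)
      (simp_all add: bilinear_ladd[OF bl] bilinear_radd[OF bl] bilinear_lmul[OF bl]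
        bilinear_rmul[OF bl] inner_add_right)
  moreover have "bilinear (\<lambda>x y :: real^4. 0 :: real)"
    by (simp add: bilinear_def linear_zero)
  ultimately have "(\<lambda>x y. a \<bullet> b x y) = (\<lambda>x y. 0)"
    by (rule bilinear_eq_stdbasis) (auto simp: Basis_vec_def A A0 simp flip: B_def)
  then show thesis
    using that[of a] a(1) True by (simp add: unimodular_def fun_eq_iff)
qed

section \<open>Splitting off the last coordinate\<close>

text \<open>The hyperplane \<open>x $ 4 = 0\<close> contains all brackets, hence is an ideal.
  Identified with \<open>real^3\<close> it becomes \<open>g\<close>, and bracketing with the last
  basis vector gives \<open>D\<close>.\<close>

lemma D_extension_if_adapted:
  fixes b :: "real^4 \<Rightarrow> real^4 \<Rightarrow> real^4"
  assumes L: "lie_algebra b" and b4: "\<And>x y. b x y $ 4 = 0"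
    and tr: "\<And>x. x $ 4 = 0 \<Longrightarrow> trace (matrix (b x)) = 0"
  obtains g :: "real^3 \<Rightarrow> real^3 \<Rightarrow> real^3" and D
  where "lie_algebra g" "unimodular g" "derivation g D" "lie_isomorphic b (D_extension g D)"
proof -
  have bl: "bilinear b"
    using L by (simp add: lie_algebra_def)
  define E :: "real^3 \<Rightarrow> real^4"
    where "E x = x $ 1 *\<^sub>R axis 1 1 + x $ 2 *\<^sub>R axis 2 1 + x $ 3 *\<^sub>R axis 3 1" for x
  define P :: "real^4 \<Rightarrow> real^3" where "P y = vector [y $ 1, y $ 2, y $ 3]" for y
  define e :: "real^4" where "e = axis 4 1"
  have linE: "linear E"
    by (rule linearI) (simp_all add: E_def algebra_simps)
  have linP: "linear P"
    by (rule linearI) (simp_all add: P_def vec_eq_iff forall_3)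
  have PE: "P (E x) = x" for x
    by (simp add: P_def E_def vec_eq_iff forall_3 axis_def)
  have E4: "E x $ 4 = 0" for x
    by (simp add: E_def axis_def)
  have EP: "E (P y) + y $ 4 *\<^sub>R e = y" for y
    by (simp add: P_def E_def e_def vec_eq_iff forall_4 axis_def)
  \<comment> \<open>Projecting a bracket loses nothing, so identities for iterated brackets of
    \<open>b\<close> pass to \<open>g\<close> and \<open>D\<close>.\<close>
  have EPb: "E (P (b x y)) = b x y" for x y
    using EP[of "b x y"] by (simp add: b4)
  note bs = bilinear_ladd[OF bl] bilinear_radd[OF bl] bilinear_lmul[OF bl] bilinear_rmul[OF bl]
    linear_add[OF linE] linear_add[OF linP] linear_cmul[OF linE] linear_cmul[OF linP]
  define g where "g x y = P (b (E x) (E y))" for x y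
  define D where "D x = P (b (E x) e)" for x
  have bxx: "b x x = 0" for x
    using L by (simp add: lie_algebra_def)
  have jacb: "b x (b y z) + b y (b z x) + b z (b x y) = 0" for x y z
    using L by (simp add: lie_algebra_def)
  have "bilinear g"
    unfolding bilinear_def by (intro conjI allI linearI) (simp_all add: g_def bs)
  then have lie: "lie_algebra g"
    using jacb by (simp add: lie_algebra_def g_def EPb bxx linear_0[OF linP] flip: linear_add[OF linP])
  have uni: "unimodular g"
    unfolding unimodular_def
  proof
    fix x
    \<comment> \<open>The two matrices share the first three diagonal entries, and the fourth entry
      for \<open>b\<close> vanishes by \<open>b4\<close>.\<close>
    have "trace (matrix (g x)) = trace (matrix (b (E x)))"
      by (simp add: trace_def matrix_def g_def P_def sum_3 sum_4 b4) (simp add: E_def axis_def)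
    also have "\<dots> = 0"
      by (rule tr) (rule E4)
    finally show "trace (matrix (g x)) = 0" .
  qed
  have der: "derivation g D"
    unfolding derivation_def
  proof (intro conjI allI)
    show "linear D"
      by (rule linearI) (simp_all add: D_def bs)
    show "D (g x y) = g (D x) y + g x (D y)" for x y
    proof -
      \<comment> \<open>The Leibniz rule for \<open>D\<close> is the Jacobi identity for
        \<open>e\<close>, \<open>E x\<close>, \<open>E y\<close> after swapping arguments.\<close>
      have "b (b (E x) (E y)) e = - b e (b (E x) (E y))"
        by (rule lie_algebra_anticomm[OF L])
      moreover have "b (b (E x) e) (E y) = - b (E y) (b (E x) e)"
        by (rule lie_algebra_anticomm[OF L])
      moreover have "b (E y) (b (E x) e) = - b (E y) (b e (E x))"
        by (subst lie_algebra_anticomm[OF L, of "E x" e]) (simp add: bilinear_rneg[OF bl])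
      ultimately have "b (b (E x) (E y)) e = b (b (E x) e) (E y) + b (E x) (b (E y) e)"
        using jacb[of e "E x" "E y"] by (simp add: algebra_simps add_eq_0_iff)
      then show ?thesis
        by (simp add: D_def g_def EPb bs)
    qed
  qed
  define f where "f y = (P y, y $ 4)" for y
  have "linear f"
    by (rule linearI) (simp_all add: f_def bs)
  moreover have "bij f"
  proof (rule bij_betw_byWitness[where f' = "\<lambda>u. E (fst u) + snd u *\<^sub>R e"])
    have "P e = 0"
      by (simp add: P_def e_def axis_def vec_eq_iff forall_3)
    then show "\<forall>u\<in>UNIV. f (E (fst u) + snd u *\<^sub>R e) = u"
      by (simp add: f_def bs PE E4) (simp add: e_def)
  qed (simp_all add: f_def EP)
  moreover have "f (b x y) = D_extension g D (f x) (f y)" for x y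
  proof -
    \<comment> \<open>Since \<open>D\<close> is defined with \<open>e\<close> on the right, the term
      with \<open>e\<close> on the left must be flipped; this is the minus sign in
      \<open>D_extension\<close>.\<close>
    have "b e (E (P y)) = - b (E (P y)) e"
      by (rule lie_algebra_anticomm[OF L])
    then have "P (b (E (P x) + x $ 4 *\<^sub>R e) (E (P y) + y $ 4 *\<^sub>R e)) =
        g (P x) (P y) + y $ 4 *\<^sub>R D (P x) - x $ 4 *\<^sub>R D (P y)"
      by (simp add: bs bxx g_def D_def linear_diff[OF linP])
    then show ?thesis
      by (simp add: f_def D_extension_def b4 EP)
  qed
  ultimately have "lie_isomorphic b (D_extension g D)"
    unfolding lie_isomorphic_def by blast
  with lie uni der show thesis
    by (rule that)
qed

section \<open>Reduction to adapted coordinates\<close>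

theorem proposition2p3:
  fixes h :: "'h::real_vector \<Rightarrow> 'h \<Rightarrow> 'h"
  assumes "lie_algebra h"
    and "dim (UNIV :: 'h set) = 4"
  shows "\<exists>g :: real^3 \<Rightarrow> real^3 \<Rightarrow> real^3.
           lie_algebra g \<and> unimodular g \<and>
           ((\<exists>\<omega>. two_cocycle g \<omega> \<and> lie_isomorphic h (central_extension g \<omega>)) \<or>
            (\<exists>D. derivation g D \<and> lie_isomorphic h (D_extension g D)))"
proof -
  obtain F :: "'h \<Rightarrow> real^4" and G
    where F: "linear F" and G: "linear G" and GF: "\<And>x. G (F x) = x" and FG: "\<And>y. F (G y) = y"
    using obtain_coordinates[where 'n = 4] assms(2) by auto
  define b where "b x y = F (h (G x) (G y))" for x y
  have Lb: "lie_algebra b"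
    unfolding b_def by (rule lie_algebra_transport[OF assms(1) F G GF])
  then obtain a where a: "a \<noteq> 0" "\<And>x y. a \<bullet> b x y = 0"
      "\<And>x. a \<bullet> x = 0 \<Longrightarrow> trace (matrix (b x)) = 0"
    using ex_traceless_functional by metis
  \<comment> \<open>Turning \<open>a\<close> onto the fourth axis makes the functional a positive
    multiple of the fourth coordinate, as the adapted form requires.\<close>
  obtain R :: "real^4 \<Rightarrow> real^4" where R: "orthogonal_transformation R" and Ra: "R a = norm a *\<^sub>R axis 4 1"
    using orthogonal_transformation_exists[of a "norm a *\<^sub>R axis 4 1"] by auto
  have linR: "linear R" "linear (inv R)" and bijR: "bij R"
    using R by (auto simp: orthogonal_transformation_linear orthogonal_transformation_inv
        orthogonal_transformation_bij)
  have inv: "inv R (R x) = x" "R (inv R x) = x" for x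
    using bijR by (simp_all add: bij_is_inj bij_is_surj surj_f_inv_f)
  have R4: "norm a * R x $ 4 = a \<bullet> x" for x
  proof -
    have "R a \<bullet> R x = a \<bullet> x"
      using R by (simp add: orthogonal_transformation_def)
    then show ?thesis
      by (simp add: Ra inner_axis')
  qed
  define b' where "b' x y = R (b (inv R x) (inv R y))" for x y
  have Lb': "lie_algebra b'"
    unfolding b'_def by (rule lie_algebra_transport[OF Lb linR inv(1)])
  have b'4: "b' x y $ 4 = 0" for x y
    using R4[of "b (inv R x) (inv R y)"] a(1,2) by (simp add: b'_def)
  have trb': "trace (matrix (b' x)) = 0" if "x $ 4 = 0" for x
  proof -
    have "a \<bullet> inv R x = 0"
      using R4[of "inv R x"] that by (simp add: inv)
    moreover have "linear (b (inv R x))"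
      using Lb by (simp add: lie_algebra_def bilinear_def)
    ultimately show ?thesis
      using trace_conjugate[OF linR _ inv(1)] a(3) by (simp add: b'_def [abs_def])
  qed
  obtain g :: "real^3 \<Rightarrow> real^3 \<Rightarrow> real^3" and D
    where g: "lie_algebra g" "unimodular g" "derivation g D"
      and iso: "lie_isomorphic b' (D_extension g D)"
    using D_extension_if_adapted[OF Lb' b'4 trb'] by blast
  obtain f where f: "linear f" "bij f" "\<And>x y. f (b' x y) = D_extension g D (f x) (f y)"
    using iso by (auto simp: lie_isomorphic_def)
  have "bij F"
    by (rule bij_betw_byWitness[where f' = G]) (simp_all add: GF FG)
  then have "bij (f \<circ> R \<circ> F)"
    using f(2) bijR by (simp add: bij_comp)
  moreover have "linear (f \<circ> R \<circ> F)"
    using f(1) linR F by (simp add: linear_compose)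
  moreover have "(f \<circ> R \<circ> F) (h x y) = D_extension g D ((f \<circ> R \<circ> F) x) ((f \<circ> R \<circ> F) y)" for x y
    using f(3)[of "R (F x)" "R (F y)"] by (simp add: b'_def b_def inv GF)
  ultimately have "lie_isomorphic h (D_extension g D)"
    unfolding lie_isomorphic_def by blast
  with g show ?thesis
    by blast
qed

end
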